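(* Let $A,B$ be real symmetric positive-definite $2n\times 2n$ matrices and let $\mathcal{G}=\{A\sharp_tB : t\in[0,1]\}$. If $A$ and $B$ are simultaneously diagonalizable by a symplectic matrix in the sense of Williamson's theorem, then the family $\mathcal{G}$ is also simultaneously diagonalizable by a symplectic matrix in the sense of Williamson's theorem.
   Context: For symmetric positive-definite $A,B$ and $t\in[0,1]$, $A\sharp_tB:=A^{1/2}(A^{-1/2}BA^{-1/2})^tA^{1/2}$, with real powers of positive-definite matrices defined by the spectral theorem. Let $J=\begin{bmatrix}0_n & I_n\\ -I_n & 0_n\end{bmatrix}$; a real $2n\times 2n$ matrix $S$ is symplectic if $S^TJS=J$. A family of symmetric positive-definite $2n\times 2n$ matrices is simultaneously diagonalizable by a symplectic matrix in the sense of Williamson's theorem if there is a single symplectic matrix $S$ such that for every $M$ in the family $S^TMS=\begin{bmatrix}D_M&0\\0&D_M\end{bmatrix}$ for some $n\times n$ diagonal matrix $D_M$ with positive diagonal entries. *)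

theory Defs
  imports "HOL-Analysis.Analysis"
begin

text \<open>
  Matrices of size \<open>2n \<times> 2n\<close> are indexed by \<open>'n + 'n\<close>, where \<open>n = CARD('n)\<close>: the indices
  \<open>Inl i\<close> are the first \<open>n\<close> rows/columns and the indices \<open>Inr i\<close> the last \<open>n\<close>.
\<close>

definition block_matrix ::
    "real^'n^'n \<Rightarrow> real^'n^'n \<Rightarrow> real^'n^'n \<Rightarrow> real^'n^'n \<Rightarrow> real^('n + 'n)^('n + 'n)" where
  "block_matrix P Q R T = (\<chi> i j.
     (case i of
        Inl a \<Rightarrow> (case j of Inl b \<Rightarrow> P $ a $ b | Inr b \<Rightarrow> Q $ a $ b)
      | Inr a \<Rightarrow> (case j of Inl b \<Rightarrow> R $ a $ b | Inr b \<Rightarrow> T $ a $ b)))"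

definition diag_matrix :: "real^'m \<Rightarrow> real^'m^'m" where
  "diag_matrix d = (\<chi> i j. if i = j then d $ i else 0)"

definition sym_posdef :: "real^'m^'m \<Rightarrow> bool" where
  "sym_posdef M \<longleftrightarrow> transpose M = M \<and> (\<forall>x. x \<noteq> 0 \<longrightarrow> x \<bullet> (M *v x) > 0)"

text \<open>
  Real powers through the spectral theorem: if \<open>M = U diag(d) U\<^sup>T\<close> with \<open>U\<close> orthogonal and
  \<open>d > 0\<close>, then \<open>M\<^sup>t = U diag(d\<^sup>t) U\<^sup>T\<close>. The result is the same for every such decomposition,
  and one exists exactly when \<open>M\<close> is symmetric positive definite; for other \<open>M\<close> the value
  is unspecified.
\<close>

definition posdef_powr :: "real^'m^'m \<Rightarrow> real \<Rightarrow> real^'m^'m" where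
  "posdef_powr M t = (THE P. \<exists>U d. orthogonal_matrix U \<and> (\<forall>i. d $ i > 0) \<and>
     M = U ** diag_matrix d ** transpose U \<and>
     P = U ** diag_matrix (\<chi> i. d $ i powr t) ** transpose U)"

definition weighted_geo_mean :: "real^'m^'m \<Rightarrow> real^'m^'m \<Rightarrow> real \<Rightarrow> real^'m^'m" where
  "weighted_geo_mean A B t =
     posdef_powr A (1/2) **
     posdef_powr (posdef_powr A (- 1/2) ** B ** posdef_powr A (- 1/2)) t **
     posdef_powr A (1/2)"

definition standard_symplectic_form :: "real^('n::finite + 'n)^('n + 'n)" where
  "standard_symplectic_form = block_matrix 0 (mat 1) (- mat 1) 0"

definition symplectic_matrix :: "real^('n::finite + 'n)^('n + 'n) \<Rightarrow> bool" where
  "symplectic_matrix S \<longleftrightarrow>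
     transpose S ** standard_symplectic_form ** S = standard_symplectic_form"

text \<open>
  Positive definiteness of the members of the family is not repeated here: it follows from
  \<open>S\<^sup>T M S\<close> being a positive diagonal matrix, as a symplectic matrix is invertible.
\<close>

definition williamson_simultaneously_diagonalizable ::
    "(real^('n::finite + 'n)^('n + 'n)) set \<Rightarrow> bool" where
  "williamson_simultaneously_diagonalizable F \<longleftrightarrow>
     (\<exists>S. symplectic_matrix S \<and>
        (\<forall>M\<in>F. \<exists>d :: real^'n. (\<forall>i. d $ i > 0) \<and>
           transpose S ** M ** S = block_matrix (diag_matrix d) 0 0 (diag_matrix d)))"

end

theory Submission
  imports Defs
begin

text \<open>
  The geometric mean is equivariant under congruence, so a symplectic \<open>S\<close> that brings \<open>A\<close> and \<open>B\<close>
  to the diagonal forms \<open>D\<close> and \<open>E\<close> brings \<open>A \<sharp>\<^sub>t B\<close> to \<open>D\<^sup>1\<^sup>-\<^sup>t E\<^sup>t\<close>. Concretely, with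
  \<open>R = A\<^sup>1\<^sup>/\<^sup>2\<close> the matrix \<open>U = R S D\<^sup>-\<^sup>1\<^sup>/\<^sup>2\<close> is orthogonal and diagonalizes
  \<open>R\<^sup>-\<^sup>1 B R\<^sup>-\<^sup>1\<close> to \<open>E D\<^sup>-\<^sup>1\<close>, while \<open>U\<^sup>T R S = D\<^sup>1\<^sup>/\<^sup>2\<close>.
\<close>

section \<open>The spectral theorem\<close>

text \<open>First-order condition for a minimum at \<open>s = 0\<close>: near zero the linear term
  dominates, so a nonzero \<open>a\<close> would give a negative value for a small \<open>s\<close>
  of opposite sign.\<close>

lemma linear_coeff_zero_if_quadratic_nonneg:
  fixes a b :: real
  assumes "\<And>s. 0 \<le> s * a + s\<^sup>2 * b"
  shows "a = 0"
proof (rule ccontr)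
  assume "a \<noteq> 0"
  \<comment> \<open>Any positive \<open>c > b\<close> will do: at \<open>s = - a / c\<close> the
    expression becomes \<open>a\<^sup>2 / c\<^sup>2 * (b - c)\<close>.\<close>
  define c where "c = \<bar>b\<bar> + 1"
  have "c > 0" "b < c" by (auto simp: c_def)
  have "0 \<le> (- a / c) * a + (- a / c)\<^sup>2 * b" by (rule assms)
  also have "\<dots> = a\<^sup>2 / c\<^sup>2 * (b - c)"
    using \<open>c > 0\<close> by (simp add: field_simps power2_eq_square)
  also have "\<dots> < 0"
    using \<open>a \<noteq> 0\<close> \<open>c > 0\<close> \<open>b < c\<close> by (intro mult_pos_neg) auto
  finally show False by simp
qed

text \<open>Variational argument: the quadratic form \<open>x \<bullet> f x\<close> attains a
  maximum on the compact unit sphere of \<open>V\<close>, and stationarity at the maximizer is the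
  eigenvalue equation.\<close>

lemma selfadjoint_has_eigenvector:
  fixes f :: "'a::euclidean_space \<Rightarrow> 'a"
  assumes "linear f" and sa: "\<And>x y. f x \<bullet> y = x \<bullet> f y"
    and V: "subspace V" "f ` V \<subseteq> V" "V \<noteq> {0}"
  obtains v l where "v \<in> V" "norm v = 1" "f v = l *\<^sub>R v"
proof -
  interpret f: linear f by fact
  let ?K = "V \<inter> sphere 0 1"
  obtain u where u: "u \<in> V" "u \<noteq> 0"
    using V subspace_0 by blast
  have "u /\<^sub>R norm u \<in> ?K"
    using u V(1) by (simp add: subspace_scale)
  moreover have "compact ?K"
    using V(1) by (simp add: closed_Int_compact closed_subspace)
  moreover have "continuous_on ?K (\<lambda>x. x \<bullet> f x)"
    using \<open>linear f\<close> by (intro continuous_intros linear_continuous_on) (simp add: linear_linear)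
  ultimately obtain v where v: "v \<in> ?K" and max: "\<And>x. x \<in> ?K \<Longrightarrow> x \<bullet> f x \<le> v \<bullet> f v"
    using continuous_attains_sup[of ?K "\<lambda>x. x \<bullet> f x"] by blast
  define l where "l = v \<bullet> f v"
  \<comment> \<open>The quadratic form of \<open>l - f\<close>. By homogeneity, maximality of
    \<open>l\<close> on the unit sphere makes it nonnegative on all of \<open>V\<close>, with value
    zero at \<open>v\<close>.\<close>
  define g where "g x = l * (x \<bullet> x) - x \<bullet> f x" for x
  have vv: "v \<bullet> v = 1" using v by (simp add: norm_eq_1)
  have g_nonneg: "0 \<le> g x" if "x \<in> V" for x
  proof (cases "x = 0")
    case False
    have "x /\<^sub>R norm x \<in> ?K"
      using that False V(1) by (simp add: subspace_scale)
    from max[OF this] have "x \<bullet> f x / (norm x)\<^sup>2 \<le> l"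
      by (simp add: f.scaleR l_def power2_eq_square divide_simps)
    then show ?thesis
      using False by (simp add: g_def divide_simps dot_square_norm)
  qed (simp add: g_def)
  \<comment> \<open>The residual of the eigenvalue equation is itself the test direction: the linear
    coefficient of \<open>g (v + s *\<^sub>R w)\<close> in \<open>s\<close> is
    \<open>2 * (w \<bullet> w)\<close>, and its vanishing forces \<open>w = 0\<close>.\<close>
  define w where "w = l *\<^sub>R v - f v"
  have "w \<in> V"
    using v V by (auto simp: w_def intro!: subspace_diff subspace_scale)
  have "0 \<le> s * (2 * (w \<bullet> w)) + s\<^sup>2 * g w" for s
  proof -
    have "v + s *\<^sub>R w \<in> V"
      using v \<open>w \<in> V\<close> V(1) by (simp add: subspace_add subspace_scale)
    moreover have "v \<bullet> f w = w \<bullet> f v"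
      by (metis sa inner_commute)
    then have "g (v + s *\<^sub>R w) = g v + s * (2 * (l * (w \<bullet> v) - w \<bullet> f v)) + s\<^sup>2 * g w"
      by (simp add: g_def f.add f.scaleR inner_add_left inner_add_right inner_commute[of v w]
          power2_eq_square algebra_simps)
    moreover have "g v = 0" by (simp add: g_def vv l_def)
    moreover have "l * (w \<bullet> v) - w \<bullet> f v = w \<bullet> w"
      by (subst (3) w_def) (simp add: inner_diff_right)
    ultimately show ?thesis using g_nonneg[of "v + s *\<^sub>R w"] by simp
  qed
  from linear_coeff_zero_if_quadratic_nonneg[OF this] have "f v = l *\<^sub>R v"
    by (simp add: w_def)
  with v show ?thesis by (intro that[of v l]) auto
qed

text \<open>Induction on the dimension, over all invariant subspaces: a unit eigenvector is split
  off, and its orthogonal complement in \<open>V\<close> is again invariant.\<close>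

lemma selfadjoint_orthonormal_eigenbasis:
  fixes f :: "'a::euclidean_space \<Rightarrow> 'a"
  assumes "linear f" and sa: "\<And>x y. f x \<bullet> y = x \<bullet> f y"
    and "subspace V" "f ` V \<subseteq> V"
  shows "\<exists>B\<subseteq>V. finite B \<and> card B = dim V \<and> pairwise orthogonal B \<and>
    (\<forall>b\<in>B. norm b = 1 \<and> (\<exists>l. f b = l *\<^sub>R b))"
  using assms(3,4)
proof (induction "dim V" arbitrary: V)
  case 0
  then show ?case by (intro exI[of _ "{}"]) auto
next
  case (Suc n)
  have "V \<noteq> {0}" using Suc.hyps(2) by auto
  with Suc.prems obtain v l where v: "v \<in> V" "norm v = 1" "f v = l *\<^sub>R v"
    using selfadjoint_has_eigenvector[OF assms(1) sa] by metis
  define W where "W = {x \<in> V. orthogonal v x}"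
  have W: "W = {y \<in> V. \<forall>x\<in>span {v}. orthogonal x y}"
    by (auto simp: W_def span_singleton orthogonal_def span_base)
  have "v \<noteq> 0" using v by auto
  then have "dim W + 1 = dim V"
    unfolding W using Suc.prems(1) v(1)
      dim_subspace_orthogonal_to_vectors[of "span {v}" V]
    by (simp add: span_minimal)
  moreover have "subspace W"
    using Suc.prems(1) unfolding W_def subspace_def
    by (auto simp: orthogonal_def inner_add_right)
  \<comment> \<open>Self-adjointness moves \<open>f\<close> onto the eigenvector:
    \<open>v \<bullet> f x = f v \<bullet> x = l * (v \<bullet> x) = 0\<close>.\<close>
  moreover have "f ` W \<subseteq> W"
    using Suc.prems(2) v(3) by (auto simp: W_def orthogonal_def sa[symmetric])
  ultimately obtain B where B: "B \<subseteq> W" "finite B" "card B = dim W" "pairwise orthogonal B"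
    "\<forall>b\<in>B. norm b = 1 \<and> (\<exists>l. f b = l *\<^sub>R b)"
    using Suc.hyps(1)[of W] Suc.hyps(2) by auto
  have "v \<notin> B"
    using B(1) \<open>v \<noteq> 0\<close> by (auto simp: W_def orthogonal_def)
  have "insert v B \<subseteq> V" using B(1) v(1) by (auto simp: W_def)
  moreover have "pairwise orthogonal (insert v B)"
    using B(1,4) by (auto simp: pairwise_insert W_def orthogonal_commute)
  ultimately show ?case
    using B v \<open>v \<notin> B\<close> \<open>dim W + 1 = dim V\<close>
    by (intro exI[of _ "insert v B"]) auto
qed

section \<open>Algebra of diagonal matrices\<close>

lemma transpose_diag_matrix [simp]: "transpose (diag_matrix d) = diag_matrix d"
  by (auto simp: diag_matrix_def transpose_def vec_eq_iff)

lemma matrix_mul_diag: "(M ** diag_matrix d) $ i $ j = M $ i $ j * d $ j"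
  by (simp add: matrix_matrix_mult_def diag_matrix_def if_distrib cong: if_cong)

lemma diag_matrix_mul: "(diag_matrix d ** M) $ i $ j = d $ i * M $ i $ j"
  by (simp add: matrix_matrix_mult_def diag_matrix_def if_distrib if_distribR cong: if_cong)

lemma diag_matrix_mul_diag_matrix:
  "diag_matrix d ** diag_matrix e = diag_matrix (\<chi> i. d $ i * e $ i)"
  by (auto simp: vec_eq_iff matrix_mul_diag) (auto simp: diag_matrix_def)

lemma diag_matrix_one: "diag_matrix (\<chi> i. 1) = mat 1"
  by (simp add: diag_matrix_def mat_def vec_eq_iff)

lemma inner_matrix_vector_transpose:
  fixes M :: "real^'m^'n"
  shows "(M *v x) \<bullet> y = x \<bullet> (transpose M *v y)"
  by (simp add: dot_lmul_matrix flip: vector_transpose_matrix)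

theorem symmetric_matrix_spectral:
  fixes M :: "real^'m^'m"
  assumes "transpose M = M"
  obtains U d where "orthogonal_matrix U" "M = U ** diag_matrix d ** transpose U"
proof -
  have "(M *v x) \<bullet> y = x \<bullet> (M *v y)" for x y
    using inner_matrix_vector_transpose[of M x y] assms by simp
  then obtain B where B: "finite B" "card B = CARD('m)" "pairwise orthogonal B"
    and unit: "\<And>b. b \<in> B \<Longrightarrow> norm b = 1" and eig: "\<And>b. b \<in> B \<Longrightarrow> \<exists>l. M *v b = l *\<^sub>R b"
    using selfadjoint_orthonormal_eigenbasis[of "(*v) M" UNIV] by auto
  \<comment> \<open>The eigenbasis has as many elements as there are indices, so it can be
    enumerated as the columns of \<open>U\<close>.\<close>
  obtain b where b: "bij_betw b (UNIV :: 'm set) B"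
    using B finite_same_card_bij[of "UNIV :: 'm set" B] by auto
  then have bB: "b i \<in> B" for i by (auto simp: bij_betw_def)
  obtain d where d: "\<And>i. M *v b i = d i *\<^sub>R b i"
    using eig[OF bB] by metis
  define U :: "real^'m^'m" where "U = (\<chi> i j. b j $ i)"
  have col: "column j U = b j" for j by (simp add: column_def U_def)
  have "orthogonal_matrix U"
    unfolding orthogonal_matrix_orthonormal_columns col
    using unit[OF bB] pairwiseD[OF B(3) bB bB] b by (metis bij_betw_def inj_eq)
  have "M ** U = U ** diag_matrix (\<chi> i. d i)"
  proof -
    have "(M ** U) $ i $ j = (M *v b j) $ i" for i j
      by (simp add: matrix_matrix_mult_def matrix_vector_mult_def U_def)
    then show ?thesis
      by (simp add: vec_eq_iff matrix_mul_diag d U_def)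
  qed
  then have "U ** diag_matrix (\<chi> i. d i) ** transpose U = M ** (U ** transpose U)"
    by (simp add: matrix_mul_assoc)
  also have "\<dots> = M" using \<open>orthogonal_matrix U\<close> by (simp add: orthogonal_matrix_def)
  finally show ?thesis using that[OF \<open>orthogonal_matrix U\<close>] by metis
qed

lemma sym_posdef_spectral:
  assumes "sym_posdef M"
  obtains U d where "orthogonal_matrix U" "\<And>i. d $ i > 0" "M = U ** diag_matrix d ** transpose U"
proof -
  obtain U d where U: "orthogonal_matrix U" and M: "M = U ** diag_matrix d ** transpose U"
    using assms symmetric_matrix_spectral unfolding sym_posdef_def by metis
  have UU: "transpose U ** U = mat 1" using U by (simp add: orthogonal_matrix_def)
  have "d $ i > 0" for i
  proof -
    \<comment> \<open>The form of \<open>M\<close> is tested on the \<open>i\<close>-th column of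
      \<open>U\<close>, where its value is exactly \<open>d $ i\<close>.\<close>
    let ?e = "axis i 1 :: real^'a" and ?x = "U *v axis i 1"
    have inv: "transpose U *v ?x = ?e"
      by (simp add: matrix_vector_mul_assoc UU)
    then have "?x \<noteq> 0" by (metis axis_eq_0_iff matrix_vector_mult_0_right zero_neq_one)
    with assms have "0 < ?x \<bullet> (M *v ?x)" by (simp add: sym_posdef_def)
    also have "M *v ?x = U *v (diag_matrix d *v ?e)"
      using inv by (simp add: M flip: matrix_vector_mul_assoc)
    also have "?x \<bullet> (U *v (diag_matrix d *v ?e)) = ?e \<bullet> (diag_matrix d *v ?e)"
      by (simp add: inner_matrix_vector_transpose matrix_vector_mul_assoc UU matrix_mul_assoc)
    also have "\<dots> = d $ i"
      by (simp add: inner_axis' matrix_vector_mul_component) (simp add: diag_matrix_def inner_axis)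
    finally show ?thesis .
  qed
  then show ?thesis using that U M by blast
qed

section \<open>Real powers\<close>

text \<open>This makes the description in \<open>posdef_powr\<close> well defined. The matrix
  \<open>transpose V ** U\<close> intertwines the two diagonal matrices, hence also their entrywise
  powers.\<close>

lemma powr_diagonalization_unique:
  fixes U V :: "real^'m^'m"
  assumes U: "orthogonal_matrix U" and V: "orthogonal_matrix V"
    and eq: "U ** diag_matrix d ** transpose U = V ** diag_matrix e ** transpose V"
  shows "U ** diag_matrix (\<chi> i. d $ i powr t) ** transpose U =
    V ** diag_matrix (\<chi> i. e $ i powr t) ** transpose V"
proof -
  have UU: "transpose U ** U = mat 1" "U ** transpose U = mat 1"
    and VV: "transpose V ** V = mat 1" "V ** transpose V = mat 1"
    using U V by (auto simp: orthogonal_matrix_def)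
  define W where "W = transpose V ** U"
  have "W ** diag_matrix d = transpose V ** (U ** diag_matrix d ** transpose U) ** U"
    by (simp add: W_def UU flip: matrix_mul_assoc)
  also have "\<dots> = diag_matrix e ** W"
    unfolding eq by (simp add: W_def VV matrix_mul_assoc)
  finally have "W $ i $ j * d $ j = e $ i * W $ i $ j" for i j
    by (metis matrix_mul_diag diag_matrix_mul)
  \<comment> \<open>Either \<open>W $ i $ j = 0\<close> or the eigenvalues \<open>d $ j\<close> and
    \<open>e $ i\<close> coincide.\<close>
  then have "W $ i $ j * d $ j powr t = e $ i powr t * W $ i $ j" for i j
    by (metis mult.commute mult_left_cancel mult_zero_left)
  then have "W ** diag_matrix (\<chi> i. d $ i powr t) = diag_matrix (\<chi> i. e $ i powr t) ** W"
    by (simp add: vec_eq_iff matrix_mul_diag diag_matrix_mul)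
  then have "V ** (W ** diag_matrix (\<chi> i. d $ i powr t)) ** transpose U =
    V ** (diag_matrix (\<chi> i. e $ i powr t) ** W) ** transpose U" by simp
  moreover have "V ** W = U" "W ** transpose U = transpose V"
    by (simp_all add: W_def VV matrix_mul_assoc) (simp add: UU flip: matrix_mul_assoc)
  ultimately show ?thesis by (metis matrix_mul_assoc)
qed

lemma posdef_powr_diagonalization:
  assumes "orthogonal_matrix U" "\<And>i. d $ i > 0" "M = U ** diag_matrix d ** transpose U"
  shows "posdef_powr M t = U ** diag_matrix (\<chi> i. d $ i powr t) ** transpose U"
  unfolding posdef_powr_def
proof (rule the_equality)
  show "\<exists>U' d'. orthogonal_matrix U' \<and> (\<forall>i. d' $ i > 0) \<and>
      M = U' ** diag_matrix d' ** transpose U' \<and>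
      U ** diag_matrix (\<chi> i. d $ i powr t) ** transpose U =
      U' ** diag_matrix (\<chi> i. d' $ i powr t) ** transpose U'"
    using assms by blast
qed (use assms powr_diagonalization_unique in metis)

section \<open>Symmetry and exponent laws of matrix powers\<close>

lemma transpose_posdef_powr:
  assumes "sym_posdef M"
  shows "transpose (posdef_powr M s) = posdef_powr M s"
proof -
  obtain U d where "orthogonal_matrix U" "\<And>i. d $ i > 0" "M = U ** diag_matrix d ** transpose U"
    using sym_posdef_spectral[OF assms] by blast
  from posdef_powr_diagonalization[OF this] show ?thesis
    by (simp add: matrix_transpose_mul matrix_mul_assoc)
qed

lemma posdef_powr_zero:
  assumes "sym_posdef M"
  shows "posdef_powr M 0 = mat 1"
proof -
  obtain U d where U: "orthogonal_matrix U" "\<And>i. d $ i > 0" "M = U ** diag_matrix d ** transpose U"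
    using sym_posdef_spectral[OF assms] by blast
  \<comment> \<open>Since \<open>0 powr 0 = 0\<close> by convention, a nonzero base is what makes
    each entry equal to 1.\<close>
  from U(2) have "d $ i \<noteq> 0" for i by (metis less_irrefl)
  with posdef_powr_diagonalization[OF U] U(1) show ?thesis
    by (simp add: diag_matrix_one orthogonal_matrix_def)
qed

lemma posdef_powr_one:
  assumes "sym_posdef M"
  shows "posdef_powr M 1 = M"
proof -
  obtain U d where U: "orthogonal_matrix U" "\<And>i. d $ i > 0" "M = U ** diag_matrix d ** transpose U"
    using sym_posdef_spectral[OF assms] by blast
  from U(2) have "(\<chi> i. d $ i powr 1) = d" by (simp add: vec_eq_iff less_imp_le)
  with posdef_powr_diagonalization[OF U, of 1] U(3) show ?thesis by simp
qed

lemma posdef_powr_add: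
  assumes "sym_posdef M"
  shows "posdef_powr M (s + t) = posdef_powr M s ** posdef_powr M t"
proof -
  obtain U d where U: "orthogonal_matrix U" "\<And>i. d $ i > 0" "M = U ** diag_matrix d ** transpose U"
    using sym_posdef_spectral[OF assms] by blast
  let ?D = "\<lambda>s. diag_matrix (\<chi> i. d $ i powr s)"
  have "U ** ?D s ** transpose U ** (U ** ?D t ** transpose U) =
    U ** ?D s ** (transpose U ** U) ** ?D t ** transpose U"
    by (simp add: matrix_mul_assoc)
  also have "\<dots> = U ** (?D s ** ?D t) ** transpose U"
    using U(1) by (simp add: orthogonal_matrix_def matrix_mul_assoc)
  also have "?D s ** ?D t = ?D (s + t)"
    by (simp add: diag_matrix_mul_diag_matrix powr_add)
  finally show ?thesis by (simp add: posdef_powr_diagonalization[OF U])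
qed

section \<open>The geometric mean of simultaneously congruent-diagonal matrices\<close>

lemma weighted_geo_mean_congruence_diag:
  fixes A B S :: "real^'m^'m"
  assumes A: "sym_posdef A" and pos: "\<And>i. d $ i > 0" "\<And>i. e $ i > 0"
    and SA: "transpose S ** A ** S = diag_matrix d"
    and SB: "transpose S ** B ** S = diag_matrix e"
  shows "transpose S ** weighted_geo_mean A B t ** S =
    diag_matrix (\<chi> i. d $ i powr (1 - t) * e $ i powr t)"
proof -
  define R where "R = posdef_powr A (1/2)"
  define Q where "Q = posdef_powr A (- 1/2)"
  have RR: "R ** R = A" and RQ: "R ** Q = mat 1" and QR: "Q ** R = mat 1"
    using posdef_powr_add[OF A, of "1/2" "1/2"] posdef_powr_add[OF A, of "1/2" "-1/2"]
      posdef_powr_add[OF A, of "-1/2" "1/2"]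
    by (simp_all add: R_def Q_def posdef_powr_one[OF A] posdef_powr_zero[OF A])
  have R: "transpose R = R"
    using transpose_posdef_powr[OF A] by (simp add: R_def)
  \<comment> \<open>The Gram matrix of the columns of \<open>R ** S\<close> is
    \<open>transpose S ** A ** S = diag_matrix d\<close>, so scaling by \<open>H\<close> makes these
    columns orthonormal.\<close>
  define H where "H = diag_matrix (\<chi> i. d $ i powr (- 1/2))"
  define U where "U = R ** S ** H"
  have U': "transpose U = H ** transpose S ** R"
    by (simp add: U_def H_def R matrix_transpose_mul matrix_mul_assoc)
  have powr_half: "d $ i powr (1/2) * d $ i powr (1/2) = d $ i"
    and powr_half_mult: "d $ i powr (- 1/2) * d $ i = d $ i powr (1/2)"
    and powr_half_inverse: "d $ i powr (1/2) * d $ i powr (- 1/2) = 1"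
    and powr_minus_half: "d $ i powr (- 1/2) * d $ i powr (- 1/2) = 1 / d $ i" for i
    using pos(1)[of i] powr_add[of "d $ i" "1/2" "1/2"] powr_add[of "d $ i" "-1/2" 1]
      powr_add[of "d $ i" "1/2" "-1/2"] powr_add[of "d $ i" "-1/2" "-1/2"]
    by (simp_all add: powr_minus_divide)
  have H: "H ** diag_matrix f ** H = diag_matrix (\<chi> i. f $ i / d $ i)" for f
    using powr_minus_half
    by (simp add: H_def diag_matrix_mul_diag_matrix mult.assoc mult.left_commute[of _ "f $ _"])
  have URS: "transpose U ** R ** S = diag_matrix (\<chi> i. d $ i powr (1/2))"
  proof -
    have "transpose U ** R ** S = H ** (transpose S ** (R ** R) ** S)"
      by (simp add: U' matrix_mul_assoc)
    also have "\<dots> = diag_matrix (\<chi> i. d $ i powr (1/2))"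
      using powr_half_mult by (simp add: RR SA H_def diag_matrix_mul_diag_matrix)
    finally show ?thesis .
  qed
  have "transpose U ** U = transpose U ** R ** S ** H"
    by (simp add: U_def matrix_mul_assoc)
  also have "\<dots> = diag_matrix (\<chi> i. 1)"
    using powr_half_inverse by (simp add: URS H_def diag_matrix_mul_diag_matrix)
  \<comment> \<open>For a square matrix the one-sided identity
    \<open>transpose U ** U = mat 1\<close> already gives orthogonality.\<close>
  finally have U: "orthogonal_matrix U"
    by (simp add: orthogonal_matrix diag_matrix_one)
  then have UU: "U ** transpose U = mat 1" by (simp add: orthogonal_matrix_def)
  let ?K = "Q ** B ** Q"
  define c where "c = (\<chi> i. e $ i / d $ i)"
  \<comment> \<open>The factors \<open>R\<close> in \<open>U\<close> and its transpose cancel the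
    \<open>Q\<close> on either side of \<open>B\<close>, leaving the known congruence by
    \<open>S\<close>, scaled by \<open>H\<close>.\<close>
  have "transpose U ** ?K ** U = H ** transpose S ** (R ** Q) ** B ** (Q ** R) ** S ** H"
    by (simp add: U_def[symmetric] U' matrix_mul_assoc) (simp add: U_def matrix_mul_assoc)
  also have "\<dots> = H ** (transpose S ** B ** S) ** H"
    by (simp add: RQ QR matrix_mul_assoc)
  also have "\<dots> = diag_matrix c" by (simp add: SB H c_def)
  finally have "U ** diag_matrix c ** transpose U = (U ** transpose U) ** ?K ** (U ** transpose U)"
    by (metis matrix_mul_assoc)
  then have K: "?K = U ** diag_matrix c ** transpose U" by (simp add: UU)
  have c: "c $ i > 0" for i using pos by (simp add: c_def)
  have "transpose S ** weighted_geo_mean A B t ** S =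
    transpose S ** (R ** posdef_powr ?K t ** R) ** S"
    by (simp add: weighted_geo_mean_def R_def Q_def)
  \<comment> \<open>\<open>U\<close> diagonalizes \<open>?K\<close>, so its power is explicit; the
    outer factors regroup into \<open>transpose U ** R ** S\<close>, which is diagonal by
    \<open>URS\<close>.\<close>
  also have "\<dots> = transpose (transpose U ** R ** S) ** diag_matrix (\<chi> i. c $ i powr t) **
      (transpose U ** R ** S)"
    by (simp add: posdef_powr_diagonalization[OF U c K] matrix_transpose_mul R matrix_mul_assoc)
  also have "\<dots> = diag_matrix (\<chi> i. d $ i powr (1/2) * c $ i powr t * d $ i powr (1/2))"
    by (simp add: URS diag_matrix_mul_diag_matrix)
  also have "(\<lambda>i. d $ i powr (1/2) * c $ i powr t * d $ i powr (1/2)) =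
    (\<lambda>i. d $ i powr (1 - t) * e $ i powr t)"
  proof
    fix i
    have "d $ i powr (1/2) * c $ i powr t * d $ i powr (1/2) =
      (d $ i powr (1/2) * d $ i powr (1/2)) * c $ i powr t"
      by (simp only: mult_ac)
    also have "\<dots> = d $ i * (e $ i powr t / d $ i powr t)"
      unfolding powr_half c_def using pos[of i] by (simp add: powr_divide less_imp_le)
    also have "\<dots> = d $ i powr (1 - t) * e $ i powr t"
      using pos(1)[of i] by (simp add: powr_diff)
    finally show "d $ i powr (1/2) * c $ i powr t * d $ i powr (1/2) =
      d $ i powr (1 - t) * e $ i powr t" .
  qed
  finally show ?thesis .
qed

text \<open>Bridge from Williamson's block form to a single diagonal matrix whose entries repeat in
  both halves, so that the congruence lemma applies.\<close>

lemma block_diag_matrix_eq: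
  "block_matrix (diag_matrix d) 0 0 (diag_matrix d) =
    diag_matrix (\<chi> i. case i of Inl a \<Rightarrow> d $ a | Inr a \<Rightarrow> d $ a)"
  by (auto simp: block_matrix_def diag_matrix_def vec_eq_iff split: sum.split)

theorem corollary3p9:
  fixes A B :: "real^('n::finite + 'n)^('n + 'n)"
  assumes "sym_posdef A" and "sym_posdef B"
    and "williamson_simultaneously_diagonalizable {A, B}"
  shows "williamson_simultaneously_diagonalizable {weighted_geo_mean A B t | t. t \<in> {0..1}}"
proof -
  obtain S and d e :: "real^'n" where S: "symplectic_matrix S"
    and pos: "\<And>i. d $ i > 0" "\<And>i. e $ i > 0"
    and SA: "transpose S ** A ** S = block_matrix (diag_matrix d) 0 0 (diag_matrix d)"
    and SB: "transpose S ** B ** S = block_matrix (diag_matrix e) 0 0 (diag_matrix e)"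
    using assms(3) unfolding williamson_simultaneously_diagonalizable_def by auto
  \<comment> \<open>Only the diagonal depends on \<open>t\<close>; the same \<open>S\<close> serves
    the whole family.\<close>
  define f where "f t = (\<chi> i. d $ i powr (1 - t) * e $ i powr t)" for t
  have "transpose S ** weighted_geo_mean A B t ** S =
    block_matrix (diag_matrix (f t)) 0 0 (diag_matrix (f t))" for t
  proof -
    let ?dup = "\<lambda>d :: real^'n. \<chi> i. case i of Inl a \<Rightarrow> d $ a | Inr a \<Rightarrow> d $ a"
    have "?dup d $ i > 0" "?dup e $ i > 0" for i
      using pos by (simp_all split: sum.split)
    from weighted_geo_mean_congruence_diag[OF assms(1) this SA[unfolded block_diag_matrix_eq]
        SB[unfolded block_diag_matrix_eq]]
    have "transpose S ** weighted_geo_mean A B t ** S =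
      diag_matrix (\<chi> i. ?dup d $ i powr (1 - t) * ?dup e $ i powr t)" .
    \<comment> \<open>The formula acts entrywise, so it commutes with duplication and the two
      diagonal blocks stay equal.\<close>
    also have "(\<chi> i. ?dup d $ i powr (1 - t) * ?dup e $ i powr t) = ?dup (f t)"
      by (simp add: vec_eq_iff f_def split: sum.split)
    finally show ?thesis by (simp add: block_diag_matrix_eq)
  qed
  moreover have "f t $ i > 0" for t i
    using pos[of i] by (simp add: f_def)
  ultimately show ?thesis
    unfolding williamson_simultaneously_diagonalizable_def using S by blast
qed

end
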